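(* Let $G=(V,E)$ be a graph of maximum degree $\Delta$, let $i\in E$ be an edge, and let $\lambda>0$. Then \[ W^E\big(\mu_{E;\lambda,G},\ \mu_{E;\lambda,G-i}\big)\le 1+2\lambda\Delta . \]
   Context: For a graph $G=(V,E)$ and $\lambda>0$, $\mu_{E;\lambda,G}$ is the Gibbs distribution on matchings of $G$: $\mu_{E;\lambda,G}(M)=\lambda^{|M|}/Z$ for each matching $M\subseteq E$, where $Z=\sum_{M'}\lambda^{|M'|}$ over all matchings $M'$ of $G$. $G-i$ is the graph obtained by deleting the edge $i$; $\mu_{E;\lambda,G-i}$ denotes the Gibbs distribution on matchings of $G-i$, viewed as a distribution on subsets of $E$. $W^E(\mu,\mu')=\inf_\pi\mathbb{E}_{(X,Y)\sim\pi}|X\triangle Y|$, the infimum over all couplings $\pi$ of the distributions $\mu,\mu'$ on subsets of $E$. *)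

theory Defs
  imports "HOL-Probability.Probability"
begin

definition simple_graph :: "'a set \<Rightarrow> 'a set set \<Rightarrow> bool" where
  "simple_graph V E \<longleftrightarrow> finite V \<and> (\<forall>e\<in>E. e \<subseteq> V \<and> card e = 2)"

definition degree :: "'a set set \<Rightarrow> 'a \<Rightarrow> nat" where
  "degree E v = card {e \<in> E. v \<in> e}"

text \<open>Only meaningful for finite nonempty \<open>V\<close>, as \<^const>\<open>Max\<close> is unspecified on the empty set.\<close>

definition max_degree :: "'a set \<Rightarrow> 'a set set \<Rightarrow> nat" where
  "max_degree V E = Max (degree E ` V)"

definition matchings :: "'a set set \<Rightarrow> 'a set set set" where
  "matchings E = {M. M \<subseteq> E \<and> pairwise disjnt M}"

definition partition_function :: "'a set set \<Rightarrow> real \<Rightarrow> real" where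
  "partition_function E l = (\<Sum>M\<in>matchings E. l ^ card M)"

text \<open>Matchings, and hence the Gibbs distribution, depend on the edge set only. The result is a
  distribution on all sets of edges, so the distribution of a graph and that of the graph with an
  edge deleted have the same type. For finite \<open>E\<close> and \<open>l > 0\<close> the weights sum to one, so
  \<^const>\<open>embed_pmf\<close> yields exactly these weights; see \<open>pmf_gibbs\<close> below.\<close>

definition gibbs :: "'a set set \<Rightarrow> real \<Rightarrow> 'a set set pmf" where
  "gibbs E l =
    embed_pmf (\<lambda>M. if M \<in> matchings E then l ^ card M / partition_function E l else 0)"

definition couplings :: "'b pmf \<Rightarrow> 'c pmf \<Rightarrow> ('b \<times> 'c) pmf set" where
  "couplings \<mu> \<nu> = {\<pi>. map_pmf fst \<pi> = \<mu> \<and> map_pmf snd \<pi> = \<nu>}"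

text \<open>Intended for distributions supported on subsets of a finite ground set: the set of couplings
  is nonempty and the integrand bounded, so the real-valued infimum and expectation are the
  genuine ones.\<close>

definition wasserstein :: "'b set pmf \<Rightarrow> 'b set pmf \<Rightarrow> real" where
  "wasserstein \<mu> \<nu> =
    (INF \<pi>\<in>couplings \<mu> \<nu>. measure_pmf.expectation \<pi> (\<lambda>(X, Y). real (card (sym_diff X Y))))"

lemma simple_graph_finite_edges: "simple_graph V E \<Longrightarrow> finite E"
  unfolding simple_graph_def by (meson PowI finite_Pow_iff finite_subset subsetI)

lemma finite_matchings: "finite E \<Longrightarrow> finite (matchings E)"
  unfolding matchings_def by (rule finite_subset[of _ "Pow E"]) auto

lemma partition_function_pos:
  assumes "finite E" "l > 0"
  shows "partition_function E l > 0"
proof -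
  have "{} \<in> matchings E" by (simp add: matchings_def)
  then show ?thesis
    unfolding partition_function_def using assms
    by (intro sum_pos finite_matchings) auto
qed

lemma pmf_gibbs:
  assumes "finite E" "l > 0"
  shows "pmf (gibbs E l) M = (if M \<in> matchings E then l ^ card M / partition_function E l else 0)"
proof -
  let ?f = "\<lambda>M. if M \<in> matchings E then l ^ card M / partition_function E l else 0"
  note Z = partition_function_pos[OF assms]
  have nonneg: "0 \<le> ?f M" for M using Z assms by auto
  have "(\<integral>\<^sup>+ M. ennreal (?f M) \<partial>count_space UNIV) = (\<Sum>M\<in>matchings E. ennreal (?f M))"
    by (rule nn_integral_count_space'[OF finite_matchings[OF assms(1)]]) auto
  also have "\<dots> = ennreal (\<Sum>M\<in>matchings E. ?f M)"
    by (rule sum_ennreal) (use nonneg in blast)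
  also have "(\<Sum>M\<in>matchings E. ?f M) = 1"
    using Z by (simp add: sum_divide_distrib[symmetric] partition_function_def)
  finally show ?thesis
    unfolding gibbs_def using nonneg by (subst pmf_embed_pmf) auto
qed

end

theory Submission
  imports Defs
begin

text \<open>Deleting a vertex \<open>u\<close> moves the Gibbs distribution by at most \<open>l \<Delta>\<close>. Indeed, given that
  \<open>u\<close> is unmatched, the distribution is that of \<open>E - u\<close>; given that \<open>u\<close> is matched by an edge
  \<open>{u, w}\<close>, it is this edge added to a sample of \<open>E - u - w\<close>, which by induction is at distance at
  most \<open>1 + l \<Delta>\<close> from that of \<open>E - u\<close>. Removing the edge at \<open>u\<close> shows that the odds of \<open>u\<close> being
  matched are at most \<open>l \<Delta>\<close>, so the distance is at most
  \<open>l \<Delta> / (1 + l \<Delta>) * (1 + l \<Delta>) = l \<Delta>\<close>. For the edge \<open>i = {u, v}\<close>, given \<open>i \<notin> M\<close> the two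
  distributions agree, and given \<open>i \<in> M\<close> two vertex deletions connect \<open>E - u - v\<close> to \<open>E - i\<close>.\<close>

section \<open>Transport\<close>

text \<open>A witness coupling is demanded instead of a bound on an infimum, since witnesses can be
  glued and mixed. The cost is a nonnegative integral, so no integrability has to be
  tracked.\<close>

definition transport_le :: "'b set pmf \<Rightarrow> 'b set pmf \<Rightarrow> ennreal \<Rightarrow> bool" where
  "transport_le \<mu> \<nu> c \<longleftrightarrow>
    (\<exists>\<pi>\<in>couplings \<mu> \<nu>. (\<integral>\<^sup>+ z. of_nat (card (sym_diff (fst z) (snd z))) \<partial>\<pi>) \<le> c)"

lemma wasserstein_le_transport:
  assumes "transport_le \<mu> \<nu> (ennreal c)" "0 \<le> c"
  shows "wasserstein \<mu> \<nu> \<le> c"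
proof -
  obtain \<pi> where \<pi>: "\<pi> \<in> couplings \<mu> \<nu>"
    and le: "(\<integral>\<^sup>+ z. of_nat (card (sym_diff (fst z) (snd z))) \<partial>\<pi>) \<le> ennreal c"
    using assms(1) unfolding transport_le_def by blast
  have "wasserstein \<mu> \<nu> \<le> measure_pmf.expectation \<pi> (\<lambda>(X, Y). real (card (sym_diff X Y)))"
    unfolding wasserstein_def
    by (rule cINF_lower[OF _ \<pi>])
      (auto intro!: bdd_belowI[of _ 0] Bochner_Integration.integral_nonneg)
  \<comment> \<open>A Bochner integral that fails to exist is 0, hence at most \<open>c\<close>, so
    the bound on the nonnegative integral suffices.\<close>
  also have "\<dots> \<le> c"
    using le by (intro integral_real_bounded assms(2))
      (simp add: case_prod_beta ennreal_of_nat_eq_real_of_nat)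
  finally show ?thesis .
qed

lemma transport_le_mono: "transport_le \<mu> \<nu> c \<Longrightarrow> c \<le> d \<Longrightarrow> transport_le \<mu> \<nu> d"
  unfolding transport_le_def by (meson order_trans)

lemma transport_le_refl: "transport_le \<mu> \<mu> 0"
  unfolding transport_le_def couplings_def
  by (rule bexI[of _ "map_pmf (\<lambda>x. (x, x)) \<mu>"]) (auto simp: pmf.map_comp o_def)

lemma transport_le_sym:
  assumes "transport_le \<mu> \<nu> c"
  shows "transport_le \<nu> \<mu> c"
proof -
  obtain \<pi> where \<pi>: "\<pi> \<in> couplings \<mu> \<nu>"
    and le: "(\<integral>\<^sup>+ z. of_nat (card (sym_diff (fst z) (snd z))) \<partial>\<pi>) \<le> c"
    using assms unfolding transport_le_def by blast
  show ?thesis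
    unfolding transport_le_def
  proof (rule bexI[of _ "map_pmf prod.swap \<pi>"])
    show "map_pmf prod.swap \<pi> \<in> couplings \<nu> \<mu>"
      using \<pi> by (simp add: couplings_def pmf.map_comp o_def)
    show "(\<integral>\<^sup>+ z. of_nat (card (sym_diff (fst z) (snd z))) \<partial>map_pmf prod.swap \<pi>) \<le> c"
      using le by (simp add: Un_commute)
  qed
qed

text \<open>Disintegration along \<open>f\<close>. It serves both to glue couplings and to reveal
  part of a random matching.\<close>

lemma bind_cond_pmf_fibres: "bind_pmf (map_pmf f p) (\<lambda>y. cond_pmf p {x. f x = y}) = p"
proof -
  have "bind_pmf (map_pmf f p) (\<lambda>y. cond_pmf p {x. y = f x}) = p"
  proof (rule bind_cond_pmf_cancel)
    fix y x assume "y = f x"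
    then show "measure_pmf.prob p {x. y = f x} = measure_pmf.prob (map_pmf f p) {y. y = f x}"
      by (simp add: vimage_def)
        (rule arg_cong[where f="measure_pmf.prob p"], auto)
  qed auto
  moreover have "{x. f x = y} = {x. y = f x}" for y by auto
  ultimately show ?thesis by simp
qed

text \<open>Where \<open>X\<close> and \<open>Z\<close> differ, \<open>Y\<close> differs from one of
  them. Finiteness matters because \<open>card\<close> is 0 on infinite sets.\<close>

lemma card_sym_diff_triangle:
  assumes "finite X" "finite Y" "finite Z"
  shows "card (sym_diff X Z) \<le> card (sym_diff X Y) + card (sym_diff Y Z)"
proof -
  have "card (sym_diff X Z) \<le> card (sym_diff X Y \<union> sym_diff Y Z)"
    by (rule card_mono) (use assms in auto)
  also have "\<dots> \<le> card (sym_diff X Y) + card (sym_diff Y Z)"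
    by (rule card_Un_le)
  finally show ?thesis .
qed

text \<open>The two couplings are glued by sampling the third set from the second coupling conditioned
  on the middle set.\<close>

lemma transport_le_trans:
  assumes "transport_le \<mu> \<nu> c" "transport_le \<nu> \<rho> d"
    and fin: "\<And>X. X \<in> set_pmf \<mu> \<union> set_pmf \<nu> \<union> set_pmf \<rho> \<Longrightarrow> finite X"
  shows "transport_le \<mu> \<rho> (c + d)"
proof -
  let ?cost = "\<lambda>X Y. of_nat (card (sym_diff X Y)) :: ennreal"
  obtain \<pi> where \<pi>: "map_pmf fst \<pi> = \<mu>" "map_pmf snd \<pi> = \<nu>"
    and le1: "(\<integral>\<^sup>+ z. ?cost (fst z) (snd z) \<partial>\<pi>) \<le> c"
    using assms(1) unfolding transport_le_def couplings_def by blast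
  obtain \<sigma> where \<sigma>: "map_pmf fst \<sigma> = \<nu>" "map_pmf snd \<sigma> = \<rho>"
    and le2: "(\<integral>\<^sup>+ z. ?cost (fst z) (snd z) \<partial>\<sigma>) \<le> d"
    using assms(2) unfolding transport_le_def couplings_def by blast
  define K where "K y = cond_pmf \<sigma> {z. fst z = y}" for y
  \<comment> \<open>Keeping \<open>z\<close> next to the fresh pair makes both given couplings
    marginals of \<open>\<tau>\<close>.\<close>
  define \<tau> where "\<tau> = bind_pmf \<pi> (\<lambda>z. map_pmf (Pair z) (K (snd z)))"
  have fst_\<tau>: "map_pmf fst \<tau> = \<pi>"
    by (simp add: \<tau>_def map_bind_pmf pmf.map_comp o_def map_pmf_const bind_return_pmf')
  have "map_pmf snd \<tau> = bind_pmf (map_pmf snd \<pi>) K"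
    by (simp add: \<tau>_def map_bind_pmf pmf.map_comp o_def bind_map_pmf pmf.map_id)
  also have "\<dots> = \<sigma>"
    unfolding \<pi>(2) \<sigma>(1)[symmetric] K_def by (rule bind_cond_pmf_fibres)
  finally have snd_\<tau>: "map_pmf snd \<tau> = \<sigma>" .
  \<comment> \<open>The support of a \<open>cond_pmf\<close> is known only when its event has
    positive mass. Here it does, as \<open>snd z\<close> lies in the support of
    \<open>\<nu>\<close>, the first marginal of \<open>\<sigma>\<close>.\<close>
  have middle: "fst (snd w) = snd (fst w)" if w\<tau>: "w \<in> set_pmf \<tau>" for w
  proof -
    obtain z t where w: "w = (z, t)" "z \<in> set_pmf \<pi>" "t \<in> set_pmf (K (snd z))"
      using w\<tau> unfolding \<tau>_def by fastforce
    have "snd z \<in> set_pmf (map_pmf fst \<sigma>)"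
      using w(2) unfolding \<sigma>(1) \<pi>(2)[symmetric] by simp
    then have "set_pmf \<sigma> \<inter> {t. fst t = snd z} \<noteq> {}" by auto
    then show ?thesis using w by (simp add: K_def)
  qed
  have finw: "finite (fst (fst w))" "finite (snd (fst w))" "finite (snd (snd w))"
    if "w \<in> set_pmf \<tau>" for w
  proof -
    have "fst w \<in> set_pmf \<pi>" "snd w \<in> set_pmf \<sigma>"
      using that fst_\<tau> snd_\<tau> by (metis imageI set_map_pmf)+
    then have "fst (fst w) \<in> set_pmf \<mu>" "snd (fst w) \<in> set_pmf \<nu>" "snd (snd w) \<in> set_pmf \<rho>"
      using \<pi> \<sigma> by (metis imageI set_map_pmf)+
    then show "finite (fst (fst w))" "finite (snd (fst w))" "finite (snd (snd w))"
      using fin by auto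
  qed
  show ?thesis
    unfolding transport_le_def
  proof (rule bexI[of _ "map_pmf (\<lambda>w. (fst (fst w), snd (snd w))) \<tau>"])
    have "map_pmf (\<lambda>w. fst (fst w)) \<tau> = map_pmf fst (map_pmf fst \<tau>)"
      "map_pmf (\<lambda>w. snd (snd w)) \<tau> = map_pmf snd (map_pmf snd \<tau>)"
      by (simp_all only: pmf.map_comp o_def)
    then show "map_pmf (\<lambda>w. (fst (fst w), snd (snd w))) \<tau> \<in> couplings \<mu> \<rho>"
      unfolding fst_\<tau> snd_\<tau> \<pi> \<sigma> by (simp add: couplings_def pmf.map_comp o_def)
    have "(\<integral>\<^sup>+ w. ?cost (fst (fst w)) (snd (snd w)) \<partial>\<tau>)
        \<le> (\<integral>\<^sup>+ w. ?cost (fst (fst w)) (snd (fst w)) + ?cost (fst (snd w)) (snd (snd w)) \<partial>\<tau>)"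
    proof (rule nn_integral_mono_AE, rule AE_pmfI)
      fix w assume w: "w \<in> set_pmf \<tau>"
      show "?cost (fst (fst w)) (snd (snd w))
        \<le> ?cost (fst (fst w)) (snd (fst w)) + ?cost (fst (snd w)) (snd (snd w))"
        using card_sym_diff_triangle[OF finw[OF w]]
        unfolding middle[OF w] of_nat_add[symmetric] of_nat_le_iff .
    qed
    also have "\<dots> = (\<integral>\<^sup>+ w. ?cost (fst (fst w)) (snd (fst w)) \<partial>\<tau>)
        + (\<integral>\<^sup>+ w. ?cost (fst (snd w)) (snd (snd w)) \<partial>\<tau>)"
      by (rule nn_integral_add) auto
    also have "\<dots> = (\<integral>\<^sup>+ z. ?cost (fst z) (snd z) \<partial>map_pmf fst \<tau>)
        + (\<integral>\<^sup>+ z. ?cost (fst z) (snd z) \<partial>map_pmf snd \<tau>)"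
      by simp
    also have "\<dots> \<le> c + d"
      unfolding fst_\<tau> snd_\<tau> by (intro add_mono le1 le2)
    finally show "(\<integral>\<^sup>+ z. ?cost (fst z) (snd z)
        \<partial>map_pmf (\<lambda>w. (fst (fst w), snd (snd w))) \<tau>) \<le> c + d"
      by simp
  qed
qed

text \<open>A coupling is chosen for each outcome \<open>x\<close>, and both sides share the draw of
  \<open>x\<close>, so the costs average.\<close>

lemma transport_le_bind:
  assumes "\<And>x. x \<in> set_pmf p \<Longrightarrow> transport_le (f x) (g x) (c x)"
  shows "transport_le (bind_pmf p f) (bind_pmf p g) (\<integral>\<^sup>+ x. c x \<partial>p)"
proof -
  have "\<forall>x\<in>set_pmf p. \<exists>\<pi>. \<pi> \<in> couplings (f x) (g x) \<and>
      (\<integral>\<^sup>+ z. of_nat (card (sym_diff (fst z) (snd z))) \<partial>\<pi>) \<le> c x"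
    using assms unfolding transport_le_def by blast
  from bchoice[OF this] obtain K
    where K: "\<And>x. x \<in> set_pmf p \<Longrightarrow> K x \<in> couplings (f x) (g x)"
      and le: "\<And>x. x \<in> set_pmf p \<Longrightarrow>
        (\<integral>\<^sup>+ z. of_nat (card (sym_diff (fst z) (snd z))) \<partial>K x) \<le> c x"
    by blast
  show ?thesis
    unfolding transport_le_def
  proof (rule bexI[of _ "bind_pmf p K"])
    show "bind_pmf p K \<in> couplings (bind_pmf p f) (bind_pmf p g)"
      using K by (auto simp: couplings_def map_bind_pmf intro!: bind_pmf_cong)
    show "(\<integral>\<^sup>+ z. of_nat (card (sym_diff (fst z) (snd z))) \<partial>bind_pmf p K) \<le> (\<integral>\<^sup>+ x. c x \<partial>p)"
      using le by (auto intro!: nn_integral_mono_AE AE_pmfI)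
  qed
qed

text \<open>Only \<open>\<mu>\<close> is disintegrated; \<open>\<nu>\<close> is a constant mixture
  over the same law of \<open>f\<close>. Each value of \<open>f\<close> can then be treated as a
  separate branch.\<close>

lemma transport_le_cond:
  assumes "\<And>x. x \<in> set_pmf \<mu> \<Longrightarrow> transport_le (cond_pmf \<mu> {y. f y = f x}) \<nu> (c (f x))"
  shows "transport_le \<mu> \<nu> (\<integral>\<^sup>+ x. c (f x) \<partial>\<mu>)"
proof -
  have "transport_le (bind_pmf (map_pmf f \<mu>) (\<lambda>y. cond_pmf \<mu> {x. f x = y}))
      (bind_pmf (map_pmf f \<mu>) (\<lambda>_. \<nu>)) (\<integral>\<^sup>+ y. c y \<partial>map_pmf f \<mu>)"
    by (rule transport_le_bind) (use assms in auto)
  then show ?thesis by (simp add: bind_cond_pmf_fibres)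
qed

lemma card_sym_diff_insert_le: "card (sym_diff (insert e X) Y) \<le> Suc (card (sym_diff X Y))"
proof (cases "finite (sym_diff X Y)")
  case True
  have "card (sym_diff (insert e X) Y) \<le> card (insert e (sym_diff X Y))"
    by (rule card_mono) (use True in auto)
  also have "\<dots> \<le> Suc (card (sym_diff X Y))"
    by (simp add: card_insert_le_m1)
  finally show ?thesis .
next
  case False
  \<comment> \<open>One inserted element cannot make an infinite difference finite, so the left-hand
    \<open>card\<close> is 0.\<close>
  have "sym_diff X Y \<subseteq> insert e (sym_diff (insert e X) Y)" by auto
  with False have "infinite (sym_diff (insert e X) Y)"
    by (meson finite_insert finite_subset)
  then show ?thesis by simp
qed

lemma transport_le_insert:
  assumes "transport_le \<mu> \<nu> c"
  shows "transport_le (map_pmf (insert e) \<mu>) \<nu> (1 + c)"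
proof -
  let ?cost = "\<lambda>X Y. of_nat (card (sym_diff X Y)) :: ennreal"
  obtain \<pi> where \<pi>: "map_pmf fst \<pi> = \<mu>" "map_pmf snd \<pi> = \<nu>"
    and le: "(\<integral>\<^sup>+ z. ?cost (fst z) (snd z) \<partial>\<pi>) \<le> c"
    using assms unfolding transport_le_def couplings_def by blast
  show ?thesis
    unfolding transport_le_def
  proof (rule bexI[of _ "map_pmf (apfst (insert e)) \<pi>"])
    show "map_pmf (apfst (insert e)) \<pi> \<in> couplings (map_pmf (insert e) \<mu>) \<nu>"
      by (simp add: couplings_def \<pi>[symmetric] pmf.map_comp o_def)
    have "(\<integral>\<^sup>+ z. ?cost (insert e (fst z)) (snd z) \<partial>\<pi>) \<le> (\<integral>\<^sup>+ z. 1 + ?cost (fst z) (snd z) \<partial>\<pi>)"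
    proof (rule nn_integral_mono)
      fix z
      show "?cost (insert e (fst z)) (snd z) \<le> 1 + ?cost (fst z) (snd z)"
        using card_sym_diff_insert_le[of e "fst z" "snd z"]
        unfolding of_nat_Suc[symmetric] of_nat_le_iff .
    qed
    also have "\<dots> = 1 + (\<integral>\<^sup>+ z. ?cost (fst z) (snd z) \<partial>\<pi>)"
      by (subst nn_integral_add) auto
    also have "\<dots> \<le> 1 + c" by (intro add_mono le order_refl)
    finally show "(\<integral>\<^sup>+ z. ?cost (fst z) (snd z) \<partial>map_pmf (apfst (insert e)) \<pi>) \<le> 1 + c"
      by simp
  qed
qed

section \<open>Gibbs distributions\<close>

lemma set_pmf_gibbs: "finite E \<Longrightarrow> l > 0 \<Longrightarrow> set_pmf (gibbs E l) = matchings E"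
  using partition_function_pos[of E l] by (auto simp: set_pmf_iff pmf_gibbs split: if_splits)

lemma finite_in_matchings: "finite E \<Longrightarrow> M \<in> matchings E \<Longrightarrow> finite M"
  unfolding matchings_def using finite_subset by auto

text \<open>Both mass functions sum to 1, which forces \<open>k = 1\<close>. Distributions may thus
  be compared up to normalisation.\<close>

lemma pmf_eqI_proportional:
  assumes "\<And>x. pmf p x = k * pmf q x"
  shows "p = q"
proof -
  have "1 = (\<Sum>\<^sub>ax. pmf p x)" by (simp add: infsetsum_pmf_eq_1)
  also have "\<dots> = k * (\<Sum>\<^sub>ax. pmf q x)"
    unfolding assms by (rule infsetsum_cmult_right) (simp add: pmf_abs_summable)
  also have "\<dots> = k" by (simp add: infsetsum_pmf_eq_1)
  finally show ?thesis using assms by (intro pmf_eqI) simp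
qed

text \<open>\<open>T\<close> holds the edges whose status is revealed, \<open>S\<close> the matching
  edges found there, \<open>N\<close> the rest. As \<open>N\<close> avoids \<open>T\<close>, its
  edges are distinct from those of \<open>S\<close>, so in a common matching they must be disjoint
  from them.\<close>

lemma matchings_Un_iff:
  assumes "S \<in> matchings E" "S \<subseteq> T" "N \<inter> T = {}"
  shows "S \<union> N \<in> matchings E \<longleftrightarrow> N \<in> matchings {e \<in> E - T. \<forall>s\<in>S. disjnt e s}"
proof
  assume *: "S \<union> N \<in> matchings E"
  have "disjnt e s" if "e \<in> N" "s \<in> S" for e s
  proof -
    have "e \<noteq> s" using that assms by auto
    then show ?thesis using * that unfolding matchings_def pairwise_def by blast
  qed
  then show "N \<in> matchings {e \<in> E - T. \<forall>s\<in>S. disjnt e s}"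
    using * assms unfolding matchings_def by (auto intro: pairwise_subset)
next
  assume "N \<in> matchings {e \<in> E - T. \<forall>s\<in>S. disjnt e s}"
  then show "S \<union> N \<in> matchings E"
    using assms(1) unfolding matchings_def pairwise_def by (auto simp: disjnt_sym)
qed

text \<open>Spatial Markov property. Given the trace \<open>S\<close>, the weight factors as
  \<open>l ^ card S * l ^ card N\<close>, so the remainder \<open>N\<close> is again Gibbs
  distributed on the edges still available.\<close>

lemma cond_gibbs:
  assumes E: "finite E" and l: "l > 0" and S: "S \<in> matchings E" "S \<subseteq> T"
  shows "cond_pmf (gibbs E l) {M. M \<inter> T = S}
    = map_pmf (\<lambda>N. S \<union> N) (gibbs {e \<in> E - T. \<forall>s\<in>S. disjnt e s} l)"
    (is "?p = map_pmf ?f (gibbs ?E' l)")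
proof -
  have fin': "finite ?E'" using E by simp
  note Z = partition_function_pos[OF E l] partition_function_pos[OF fin' l]
  have "S \<inter> T = S" using S by auto
  then have ne: "set_pmf (gibbs E l) \<inter> {M. M \<inter> T = S} \<noteq> {}"
    using S by (auto simp: set_pmf_gibbs[OF E l])
  let ?P = "measure_pmf.prob (gibbs E l) {M. M \<inter> T = S}"
  have inj: "inj_on ?f (set_pmf (gibbs ?E' l))"
    unfolding set_pmf_gibbs[OF fin' l] using S(2)
    by (intro inj_onI) (auto simp: matchings_def)
  \<comment> \<open>Collects all factors that do not depend on \<open>M\<close>.\<close>
  let ?k = "l ^ card S * partition_function ?E' l / (partition_function E l * ?P)"
  have "pmf ?p M = ?k * pmf (map_pmf ?f (gibbs ?E' l)) M" for M
  proof (cases "M \<in> matchings E \<and> M \<inter> T = S")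
    case True
    define N where "N = M - T"
    have M: "M = S \<union> N" "N \<inter> T = {}" using True N_def by auto
    have N: "N \<in> matchings ?E'"
      using True matchings_Un_iff[OF S M(2)] M(1) by simp
    have "pmf (map_pmf ?f (gibbs ?E' l)) M = pmf (gibbs ?E' l) N"
      unfolding M(1) by (rule pmf_map_inj[OF inj]) (use N in \<open>simp only: set_pmf_gibbs[OF fin' l]\<close>)
    also have "\<dots> = l ^ card N / partition_function ?E' l"
      using N by (simp only: pmf_gibbs[OF fin' l] if_True)
    finally have "pmf (map_pmf ?f (gibbs ?E' l)) M = l ^ card N / partition_function ?E' l" .
    moreover have "card M = card S + card N"
      unfolding M(1) using S M(2) finite_in_matchings[OF E S(1)] finite_in_matchings[OF fin' N]
      by (intro card_Un_disjoint) auto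
    ultimately show ?thesis
      using True Z by (simp add: pmf_cond[OF ne] pmf_gibbs[OF E l] power_add)
  next
    case False
    \<comment> \<open>Everything in the image is a matching of \<open>E\<close> with trace
      \<open>S\<close>, so both masses vanish at \<open>M\<close>.\<close>
    have "M \<notin> ?f ` set_pmf (gibbs ?E' l)"
    proof
      assume "M \<in> ?f ` set_pmf (gibbs ?E' l)"
      then obtain N where N: "N \<in> matchings ?E'" "M = S \<union> N"
        unfolding set_pmf_gibbs[OF fin' l] by blast
      then have "N \<inter> T = {}" by (auto simp: matchings_def)
      with N False S matchings_Un_iff[OF S this] show False by auto
    qed
    then have "pmf (map_pmf ?f (gibbs ?E' l)) M = 0" by (rule pmf_map_outside)
    then show ?thesis
      using False by (auto simp: pmf_cond[OF ne] pmf_gibbs[OF E l])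
  qed
  then show ?thesis by (rule pmf_eqI_proportional)
qed

section \<open>Odds of a vertex being matched\<close>

lemma prob_gibbs:
  assumes "finite E" "l > 0"
  shows "measure_pmf.prob (gibbs E l) A
    = (\<Sum>M\<in>matchings E \<inter> A. l ^ card M) / partition_function E l"
proof -
  have "measure_pmf.prob (gibbs E l) A = measure_pmf.prob (gibbs E l) (matchings E \<inter> A)"
    using measure_Int_set_pmf[of "gibbs E l" A] by (simp add: set_pmf_gibbs[OF assms] Int_commute)
  also have "\<dots> = (\<Sum>M\<in>matchings E \<inter> A. pmf (gibbs E l) M)"
    by (rule measure_measure_pmf_finite) (simp add: finite_matchings assms)
  finally show ?thesis
    by (simp add: pmf_gibbs[OF assms] sum_divide_distrib)
qed

text \<open>Removing \<open>e\<close> is injective on the matchings containing \<open>e\<close> and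
  costs one factor \<open>l\<close>. The result leaves \<open>u\<close> unmatched, since the other
  edges are disjoint from \<open>e\<close>.\<close>

lemma prob_gibbs_edge_le:
  assumes "finite E" "l > 0" "u \<in> e"
  shows "measure_pmf.prob (gibbs E l) {M. e \<in> M}
    \<le> l * measure_pmf.prob (gibbs E l) {M. M \<inter> {e \<in> E. u \<in> e} = {}}"
proof -
  let ?A = "matchings E \<inter> {M. e \<in> M}" and ?B = "matchings E \<inter> {M. M \<inter> {e \<in> E. u \<in> e} = {}}"
  have "(\<Sum>M\<in>?A. l ^ card M) = (\<Sum>M\<in>?A. l * l ^ card (M - {e}))"
  proof (rule sum.cong)
    fix M assume "M \<in> ?A"
    then have "finite M" "e \<in> M" using finite_in_matchings[OF assms(1)] by auto
    then have "card M = Suc (card (M - {e}))" by (metis card_Suc_Diff1)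
    then show "l ^ card M = l * l ^ card (M - {e})" by simp
  qed simp
  also have "\<dots> = l * (\<Sum>M\<in>?A. l ^ card (M - {e}))" by (simp add: sum_distrib_left)
  also have "(\<Sum>M\<in>?A. l ^ card (M - {e})) = (\<Sum>N\<in>(\<lambda>M. M - {e}) ` ?A. l ^ card N)"
    by (subst sum.reindex) (auto simp: inj_on_def)
  also have "\<dots> \<le> (\<Sum>N\<in>?B. l ^ card N)"
  proof (rule sum_mono2)
    show "(\<lambda>M. M - {e}) ` ?A \<subseteq> ?B"
    proof
      fix N assume "N \<in> (\<lambda>M. M - {e}) ` ?A"
      then obtain M where M: "M \<subseteq> E" "pairwise disjnt M" "e \<in> M" and N: "N = M - {e}"
        by (auto simp: matchings_def)
      have "u \<notin> f" if "f \<in> N" for f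
        using pairwiseD[OF M(2), of f e] that M(3) N assms(3) by (auto simp: disjnt_iff)
      moreover have "pairwise disjnt N" using M(2) N by (auto intro: pairwise_subset)
      ultimately show "N \<in> ?B" using M N by (auto simp: matchings_def)
    qed
  qed (use assms in \<open>auto simp: finite_matchings\<close>)
  finally show ?thesis
    using partition_function_pos[OF assms(1,2)] assms(2)
    by (simp add: prob_gibbs[OF assms(1,2)] divide_right_mono)
qed

text \<open>A union bound over the edges at \<open>u\<close> gives
  \<open>p \<le> l * \<Delta> * (1 - p)\<close> for the probability \<open>p\<close> that
  \<open>u\<close> is matched. This rearranged form cancels the factor
  \<open>1 + l * \<Delta>\<close> in the vertex deletion.\<close>

lemma prob_gibbs_matched_le:
  assumes E: "finite E" and l: "l > 0" and deg: "degree E u \<le> \<Delta>"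
  shows "measure_pmf.prob (gibbs E l) {M. M \<inter> {e \<in> E. u \<in> e} \<noteq> {}} * (1 + l * \<Delta>) \<le> l * \<Delta>"
proof -
  let ?T = "{e \<in> E. u \<in> e}" and ?P = "measure_pmf.prob (gibbs E l)"
  let ?q = "?P {M. M \<inter> ?T = {}}"
  have "?P {M. M \<inter> ?T \<noteq> {}} = 1 - ?q"
    by (subst measure_pmf.prob_compl[symmetric]) (auto intro: arg_cong[where f="?P"])
  then have q: "?q = 1 - ?P {M. M \<inter> ?T \<noteq> {}}" by simp
  have "?P {M. M \<inter> ?T \<noteq> {}} \<le> ?P (\<Union>e\<in>?T. {M. e \<in> M})"
    by (rule measure_pmf.finite_measure_mono) auto
  also have "\<dots> \<le> (\<Sum>e\<in>?T. ?P {M. e \<in> M})"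
    by (rule measure_pmf.finite_measure_subadditive_finite) (use E in auto)
  also have "\<dots> \<le> (\<Sum>e\<in>?T. l * ?q)"
    by (rule sum_mono) (use prob_gibbs_edge_le[OF E l] in auto)
  also have "\<dots> = degree E u * (l * ?q)" by (simp add: degree_def)
  also have "\<dots> \<le> \<Delta> * (l * ?q)"
    using deg l by (intro mult_right_mono) auto
  finally show ?thesis unfolding q by (simp add: algebra_simps)
qed

lemma cond_gibbs_empty:
  assumes "finite E" "l > 0"
  shows "cond_pmf (gibbs E l) {M. M \<inter> T = {}} = gibbs (E - T) l"
proof -
  have "{e \<in> E - T. \<forall>s\<in>{}. disjnt e s} = E - T" by auto
  then show ?thesis
    using cond_gibbs[OF assms, of "{}" T] by (simp add: matchings_def pmf.map_id[unfolded id_def])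
qed

lemma cond_gibbs_singleton:
  assumes "finite E" "l > 0" "e \<in> E" "e \<in> T"
  shows "cond_pmf (gibbs E l) {M. M \<inter> T = {e}}
    = map_pmf (insert e) (gibbs {f \<in> E - T. disjnt f e} l)"
  using cond_gibbs[OF assms(1,2), of "{e}" T] assms(3,4) by (simp add: matchings_def)

section \<open>Deleting a vertex and deleting an edge\<close>

lemma degree_mono: "finite E \<Longrightarrow> F \<subseteq> E \<Longrightarrow> degree F u \<le> degree E u"
  unfolding degree_def by (rule card_mono) auto

text \<open>The degree bound passes to subsets of \<open>E\<close>, and \<open>u\<close> is
  generalised because the induction hypothesis is applied to the partner of
  \<open>u\<close>.\<close>

lemma transport_gibbs_delete_vertex:
  assumes "finite E" "\<And>e. e \<in> E \<Longrightarrow> card e = 2" "\<And>v. degree E v \<le> \<Delta>" "l > 0"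
  shows "transport_le (gibbs E l) (gibbs {e \<in> E. u \<notin> e} l) (ennreal (l * \<Delta>))"
  using assms(1-3)
proof (induction "card E" arbitrary: E u rule: less_induct)
  case less
  note E = less.prems(1)
  let ?T = "{e \<in> E. u \<in> e}" and ?F = "{e \<in> E. u \<notin> e}"
  \<comment> \<open>Cost of a branch: 0 if \<open>u\<close> is unmatched, else 1 for the matched
    edge plus \<open>l * \<Delta>\<close> from the induction hypothesis.\<close>
  let ?c = "\<lambda>S. if S = {} then 0 else ennreal (1 + l * \<Delta>)"
  have F: "E - ?T = ?F" by auto
  have "transport_le (gibbs E l) (gibbs ?F l) (\<integral>\<^sup>+ M. ?c (M \<inter> ?T) \<partial>gibbs E l)"
  proof (rule transport_le_cond[where f = "\<lambda>M. M \<inter> ?T"])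
    fix M assume "M \<in> set_pmf (gibbs E l)"
    then have M: "M \<in> matchings E" by (simp add: set_pmf_gibbs[OF E assms(4)])
    show "transport_le (cond_pmf (gibbs E l) {M'. M' \<inter> ?T = M \<inter> ?T}) (gibbs ?F l) (?c (M \<inter> ?T))"
    proof (cases "M \<inter> ?T = {}")
      case True
      then show ?thesis
        using cond_gibbs_empty[OF E assms(4), of ?T]
        by (simp add: F transport_le_refl)
    next
      case False
      then obtain e where e: "e \<in> M" "e \<in> E" "u \<in> e" by auto
      have MT: "M \<inter> ?T = {e}"
        using e M unfolding matchings_def pairwise_def disjnt_def by blast
      obtain w where w: "e = {u, w}"
        using less.prems(2)[OF e(2)] e(3) by (auto simp: card_2_iff)
      \<comment> \<open>The matched edge \<open>e\<close> lies in \<open>E\<close> but not in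
        \<open>?F\<close>, so the induction applies to \<open>?F\<close>.\<close>
      have "card ?F < card E"
        using e E by (intro psubset_card_mono) auto
      moreover have "degree ?F v \<le> \<Delta>" for v
        using degree_mono[OF E, of ?F v] less.prems(3)[of v] by auto
      ultimately have "transport_le (gibbs ?F l) (gibbs {f \<in> ?F. w \<notin> f} l) (ennreal (l * \<Delta>))"
        using less.hyps[of ?F w] E less.prems(2) by auto
      \<comment> \<open>The edges compatible with \<open>e\<close> are those of \<open>?F\<close>
        with \<open>w\<close> deleted too.\<close>
      moreover have "{f \<in> E - ?T. disjnt f e} = {f \<in> ?F. w \<notin> f}"
        using w by (auto simp: disjnt_def)
      ultimately have "transport_le (cond_pmf (gibbs E l) {M'. M' \<inter> ?T = {e}}) (gibbs ?F l)
          (1 + ennreal (l * \<Delta>))"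
        using cond_gibbs_singleton[OF E assms(4) e(2), of ?T] e
        by (simp add: transport_le_insert transport_le_sym)
      then show ?thesis using MT assms(4) by (simp add: ennreal_plus)
    qed
  qed
  \<comment> \<open>The average cost is \<open>1 + l * \<Delta>\<close> times the probability that
    \<open>u\<close> is matched, which the odds bound reduces to
    \<open>l * \<Delta>\<close>.\<close>
  also have "(\<integral>\<^sup>+ M. ?c (M \<inter> ?T) \<partial>gibbs E l)
      = (\<integral>\<^sup>+ M. ennreal (1 + l * \<Delta>) * indicator {M. M \<inter> ?T \<noteq> {}} M \<partial>gibbs E l)"
    by (intro nn_integral_cong) (auto simp: indicator_def)
  also have "\<dots> = ennreal (1 + l * \<Delta>) * emeasure (gibbs E l) {M. M \<inter> ?T \<noteq> {}}"
    by (rule nn_integral_cmult_indicator) simp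
  also have "\<dots> = ennreal (measure_pmf.prob (gibbs E l) {M. M \<inter> ?T \<noteq> {}} * (1 + l * \<Delta>))"
    using assms(4)
    by (simp add: measure_pmf.emeasure_eq_measure ennreal_mult[symmetric] mult.commute
        del: ennreal_plus)
  finally show ?case
    using prob_gibbs_matched_le[OF E assms(4) less.prems(3), of u]
    by (rule transport_le_mono[OF _ ennreal_leI])
qed

lemma transport_gibbs_delete_edge:
  assumes E: "finite E" and card: "\<And>e. e \<in> E \<Longrightarrow> card e = 2"
    and deg: "\<And>v. degree E v \<le> \<Delta>" and l: "l > 0" and i: "i \<in> E"
  shows "transport_le (gibbs E l) (gibbs (E - {i}) l) (ennreal (1 + 2 * l * \<Delta>))"
proof -
  let ?c = "ennreal (1 + 2 * l * \<Delta>)"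
  obtain u v where uv: "i = {u, v}" using card[OF i] by (auto simp: card_2_iff)
  define H where "H = E - {i}"
  \<comment> \<open>Deleting first \<open>u\<close> and then \<open>v\<close> from \<open>H\<close>
    leads to \<open>Huv\<close>, the graph that remains available once \<open>i\<close> is in the
    matching.\<close>
  define Hu where "Hu = {e \<in> H. u \<notin> e}"
  define Huv where "Huv = {e \<in> Hu. v \<notin> e}"
  have sub: "H \<subseteq> E" "Hu \<subseteq> E" "Huv \<subseteq> E" by (auto simp: H_def Hu_def Huv_def)
  have fin: "finite H" "finite Hu" "finite Huv" using sub[THEN finite_subset] E by auto
  have degH: "degree H w \<le> \<Delta>" "degree Hu w \<le> \<Delta>" for w
    using degree_mono[OF E sub(1)] degree_mono[OF E sub(2)] deg order_trans by blast+
  have "transport_le (gibbs H l) (gibbs Hu l) (ennreal (l * \<Delta>))"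
    unfolding Hu_def by (rule transport_gibbs_delete_vertex) (use fin card degH l sub in auto)
  moreover have "transport_le (gibbs Hu l) (gibbs Huv l) (ennreal (l * \<Delta>))"
    unfolding Huv_def by (rule transport_gibbs_delete_vertex) (use fin card degH l sub in auto)
  ultimately have "transport_le (gibbs H l) (gibbs Huv l) (ennreal (l * \<Delta>) + ennreal (l * \<Delta>))"
    by (rule transport_le_trans)
      (use fin finite_in_matchings in \<open>auto simp: set_pmf_gibbs[OF _ l]\<close>)
  moreover have "1 + (ennreal (l * \<Delta>) + ennreal (l * \<Delta>)) = ?c"
  proof -
    have "?c = ennreal (1 + (l * \<Delta> + l * \<Delta>))" by (simp add: mult.assoc)
    also have "\<dots> = ennreal 1 + ennreal (l * \<Delta> + l * \<Delta>)"
      using l by (intro ennreal_plus) auto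
    also have "ennreal (l * \<Delta> + l * \<Delta>) = ennreal (l * \<Delta>) + ennreal (l * \<Delta>)"
      using l by (intro ennreal_plus) auto
    finally show ?thesis by simp
  qed
  ultimately
  have ins: "transport_le (map_pmf (insert i) (gibbs Huv l)) (gibbs H l) ?c"
    using transport_le_insert[OF transport_le_sym] by metis
  have Huv: "{f \<in> E - {i}. disjnt f i} = Huv"
    by (auto simp: Huv_def Hu_def H_def uv disjnt_def)
  \<comment> \<open>The branch without \<open>i\<close> costs 0 and is weakened to
    \<open>?c\<close>; with the same bound in both branches the average is again
    \<open>?c\<close>.\<close>
  have "transport_le (gibbs E l) (gibbs H l) (\<integral>\<^sup>+ M. ?c \<partial>gibbs E l)"
  proof (rule transport_le_cond[where f = "\<lambda>M. M \<inter> {i}" and c = "\<lambda>_. ?c"])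
    fix M
    show "transport_le (cond_pmf (gibbs E l) {M'. M' \<inter> {i} = M \<inter> {i}}) (gibbs H l) ?c"
    proof (cases "i \<in> M")
      case True
      then have "M \<inter> {i} = {i}" by auto
      then show ?thesis
        using cond_gibbs_singleton[OF E l i, of "{i}"] ins Huv by simp
    next
      case False
      then have "M \<inter> {i} = {}" by auto
      then show ?thesis
        using cond_gibbs_empty[OF E l, of "{i}"] transport_le_mono[OF transport_le_refl]
        by (simp add: H_def)
    qed
  qed
  then show ?thesis by (simp add: H_def)
qed

theorem theorem3p6:
  fixes V :: "'a set" and E :: "'a set set" and i :: "'a set" and l :: real and \<Delta> :: nat
  assumes "simple_graph V E"
    and "max_degree V E = \<Delta>"
    and "i \<in> E"
    and "l > 0"
  shows "wasserstein (gibbs E l) (gibbs (E - {i}) l) \<le> 1 + 2 * l * real \<Delta>"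
proof (rule wasserstein_le_transport[OF transport_gibbs_delete_edge])
  show "finite E" by (rule simple_graph_finite_edges[OF assms(1)])
  show "card e = 2" if "e \<in> E" for e using that assms(1) by (simp add: simple_graph_def)
  show "degree E v \<le> \<Delta>" for v
  proof (cases "v \<in> V")
    case True
    then show ?thesis
      using assms(1,2) unfolding simple_graph_def max_degree_def by (auto intro!: Max_ge)
  next
    \<comment> \<open>The degree bound ranges over the whole type; outside \<open>V\<close> the
      degree is 0, as edges are subsets of \<open>V\<close>.\<close>
    case False
    then have "{e \<in> E. v \<in> e} = {}" using assms(1) by (auto simp: simple_graph_def)
    then show ?thesis unfolding degree_def by (simp only: card.empty)
  qed
qed (use assms in auto)

end
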